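(* Let $G$ be a connected graph. Then $G$ is a vertex-stable equimatchable graph if and only if $G$ is a complete graph, or a complete bipartite graph, or a bipartite edge-stable equimatchable graph.
   Context: All graphs are finite and simple. A graph is equimatchable if all its maximal matchings have the same cardinality. A graph $G$ is vertex-stable equimatchable if $G$ is equimatchable and $G-v$ is equimatchable for every $v\in V(G)$. An equimatchable graph $G$ is edge-stable if $G\setminus e$ (delete edge $e$, keep vertices) is equimatchable for every $e\in E(G)$. *)

theory Defs
  imports Main
begin

definition graph :: "'a set \<Rightarrow> 'a set set \<Rightarrow> bool" where
  "graph V E \<longleftrightarrow> finite V \<and> (\<forall>e\<in>E. e \<subseteq> V \<and> card e = 2)"

definition matching :: "'a set set \<Rightarrow> 'a set set \<Rightarrow> bool" where
  "matching E M \<longleftrightarrow> M \<subseteq> E \<and> (\<forall>e1\<in>M. \<forall>e2\<in>M. e1 \<noteq> e2 \<longrightarrow> e1 \<inter> e2 = {})"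

definition maximal_matching :: "'a set set \<Rightarrow> 'a set set \<Rightarrow> bool" where
  "maximal_matching E M \<longleftrightarrow> matching E M \<and>
     (\<forall>M'. matching E M' \<longrightarrow> M \<subseteq> M' \<longrightarrow> M' = M)"

definition equimatchable :: "'a set \<Rightarrow> 'a set set \<Rightarrow> bool" where
  "equimatchable V E \<longleftrightarrow>
     (\<forall>M1 M2. maximal_matching E M1 \<longrightarrow> maximal_matching E M2 \<longrightarrow> card M1 = card M2)"

definition delete_vertex_edges :: "'a set set \<Rightarrow> 'a \<Rightarrow> 'a set set" where
  "delete_vertex_edges E v = {e \<in> E. v \<notin> e}"

definition vertex_stable_equimatchable :: "'a set \<Rightarrow> 'a set set \<Rightarrow> bool" where
  "vertex_stable_equimatchable V E \<longleftrightarrow> equimatchable V E \<and>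
     (\<forall>v\<in>V. equimatchable (V - {v}) (delete_vertex_edges E v))"

definition edge_stable_equimatchable :: "'a set \<Rightarrow> 'a set set \<Rightarrow> bool" where
  "edge_stable_equimatchable V E \<longleftrightarrow> equimatchable V E \<and>
     (\<forall>e\<in>E. equimatchable V (E - {e}))"

definition adj :: "'a set set \<Rightarrow> 'a \<Rightarrow> 'a \<Rightarrow> bool" where
  "adj E u v \<longleftrightarrow> {u, v} \<in> E"

definition connected :: "'a set \<Rightarrow> 'a set set \<Rightarrow> bool" where
  "connected V E \<longleftrightarrow> V \<noteq> {} \<and> (\<forall>u\<in>V. \<forall>v\<in>V. (adj E)\<^sup>*\<^sup>* u v)"

definition complete_graph :: "'a set \<Rightarrow> 'a set set \<Rightarrow> bool" where
  "complete_graph V E \<longleftrightarrow> (\<forall>u\<in>V. \<forall>v\<in>V. u \<noteq> v \<longrightarrow> {u, v} \<in> E)"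

definition bipartite :: "'a set \<Rightarrow> 'a set set \<Rightarrow> bool" where
  "bipartite V E \<longleftrightarrow> (\<exists>A B. A \<union> B = V \<and> A \<inter> B = {} \<and>
     (\<forall>e\<in>E. \<exists>a\<in>A. \<exists>b\<in>B. e = {a, b}))"

definition complete_bipartite :: "'a set \<Rightarrow> 'a set set \<Rightarrow> bool" where
  "complete_bipartite V E \<longleftrightarrow> (\<exists>A B. A \<union> B = V \<and> A \<inter> B = {} \<and> A \<noteq> {} \<and> B \<noteq> {} \<and>
     E = {{a, b} | a b. a \<in> A \<and> b \<in> B})"

end

theory Submission
  imports Defs
begin

text \<open>
  If every path \<open>a x y b\<close> closes up, that is, \<open>a b\<close> is an edge, then a connected graph is
  complete or complete bipartite, and an augmenting path can be shortened to a single edge; this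
  property passes to vertex-deleted subgraphs, so such graphs are vertex-stable.

  Otherwise some path \<open>a x y b\<close> has \<open>a\<close>, \<open>b\<close> non-adjacent. Take a maximal matching \<open>N\<close> outside it.
  Comparing \<open>N + ax + yb\<close> with \<open>N + xy\<close>, in the graph and after deleting a vertex, shows that the
  path is induced and that its vertices alternate between lying and not lying in the set \<open>D\<close> of
  vertices missed by some maximum matching. Inducedness lets the property of lying on such a path
  spread along edges, so every edge joins \<open>D\<close> to its complement and the graph is bipartite. If
  deleting an edge at \<open>d \<in> D\<close> produced a small maximal matching, that matching would also be
  maximal, and too small, in the graph without \<open>d\<close>.

  Conversely, in a bipartite edge-stable graph suppose that, without \<open>v\<close>, the matching \<open>M\<close> is
  maximal but not maximum. Edge-stability yields two neighbours \<open>s\<close>, \<open>t\<close> of \<open>v\<close> missed by \<open>M\<close>.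
  Augmenting \<open>M\<close> off \<open>v\<close> covers only one more vertex on the side of \<open>s\<close> and \<open>t\<close>, so one of
  them stays free to be matched to \<open>v\<close>, which exceeds the matching number.
\<close>

section \<open>Edges, matchings and maximality\<close>

lemma graph_finite_edges: "graph V E \<Longrightarrow> finite E"
  by (rule finite_subset[of _ "Pow V"]) (auto simp: graph_def)

lemma graph_mono: "graph V E \<Longrightarrow> F \<subseteq> E \<Longrightarrow> graph V F"
  unfolding graph_def by blast

lemma graph_edge: "graph V E \<Longrightarrow> {u, v} \<in> E \<Longrightarrow> u \<noteq> v \<and> u \<in> V \<and> v \<in> V"
  unfolding graph_def by (cases "u = v") auto

lemma graph_edge_cases:
  assumes "graph V E" "e \<in> E"
  obtains u v where "e = {u, v}" "u \<noteq> v" "u \<in> V" "v \<in> V"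
  using assms unfolding graph_def by (metis card_2_iff insert_subset)

lemma graph_edge_other:
  assumes "graph V E" "e \<in> E" "x \<in> e"
  obtains y where "e = {x, y}" "x \<noteq> y"
proof -
  obtain u v where uv: "e = {u, v}" "u \<noteq> v" using graph_edge_cases[OF assms(1,2)] by metis
  show thesis
  proof (cases "x = u")
    case False
    then have "e = {x, u}" using uv assms(3) by auto
    with that False show thesis by blast
  qed (use that uv in blast)
qed

lemma edge_sym: "{u, v} \<in> E \<Longrightarrow> {v, u} \<in> E"
  by (simp add: insert_commute)

lemma matching_finite: "graph V E \<Longrightarrow> matching E M \<Longrightarrow> finite M"
  using graph_finite_edges unfolding matching_def by (metis finite_subset)

lemma matching_insert:
  assumes "matching E M" "e \<in> E" "e \<inter> \<Union>M = {}"
  shows "matching E (insert e M)"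
proof -
  have "e \<inter> f = {}" "f \<inter> e = {}" if "f \<in> M" for f using assms(3) that by blast+
  then show ?thesis using assms(1,2) unfolding matching_def by simp
qed

lemma matching_subset: "matching E M \<Longrightarrow> N \<subseteq> M \<Longrightarrow> matching E N"
  unfolding matching_def by blast

lemma matching_empty: "matching E {}"
  unfolding matching_def by blast

lemma card_matching_insert:
  assumes "graph V E" "matching E M" "e \<in> E" "e \<inter> \<Union>M = {}"
  shows "card (insert e M) = Suc (card M)"
proof -
  have "e \<noteq> {}" using assms(1,3) unfolding graph_def by fastforce
  then have "e \<notin> M" using assms(4) by blast
  then show ?thesis using matching_finite[OF assms(1,2)] by simp
qed

lemma matching_delete_vertex: "matching (delete_vertex_edges E v) M \<longleftrightarrow> matching E M \<and> v \<notin> \<Union>M"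
  unfolding matching_def delete_vertex_edges_def by blast

lemma matching_delete_edge: "matching (E - {e}) M \<longleftrightarrow> matching E M \<and> e \<notin> M"
  unfolding matching_def by blast

text \<open>Edges are nonempty, so a free edge, one disjoint from \<open>\<Union>M\<close>, is new
  and enlarges \<open>M\<close>. Conversely, an edge that a larger matching adds to \<open>M\<close>
  is disjoint from every edge of \<open>M\<close>, hence free.\<close>

lemma matching_maximal_iff:
  assumes "graph V E" "matching E M"
  shows "maximal_matching E M \<longleftrightarrow> (\<forall>e\<in>E. e \<inter> \<Union>M \<noteq> {})"
proof
  assume max: "maximal_matching E M"
  show "\<forall>e\<in>E. e \<inter> \<Union>M \<noteq> {}"
  proof (intro ballI notI)
    fix e assume e: "e \<in> E" "e \<inter> \<Union>M = {}"
    from matching_insert[OF assms(2) e] max have "insert e M = M"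
      unfolding maximal_matching_def by blast
    with card_matching_insert[OF assms e] show False by simp
  qed
next
  assume free: "\<forall>e\<in>E. e \<inter> \<Union>M \<noteq> {}"
  have "M' = M" if M': "matching E M'" "M \<subseteq> M'" for M'
  proof (rule ccontr)
    assume "M' \<noteq> M"
    then obtain e where e: "e \<in> M'" "e \<notin> M" using M'(2) by blast
    then have "e \<in> E" using M'(1) unfolding matching_def by blast
    moreover have "e \<inter> f = {}" if "f \<in> M" for f
      using M' e that unfolding matching_def by (metis subsetD)
    ultimately show False using free by blast
  qed
  then show "maximal_matching E M" using assms(2) unfolding maximal_matching_def by blast
qed

lemma matching_extend:
  assumes "graph V E" "matching E M"
  shows "\<exists>M'. maximal_matching E M' \<and> M \<subseteq> M'"
proof -
  have fin: "finite {M'. matching E M' \<and> M \<subseteq> M'}"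
    by (rule finite_subset[of _ "Pow E"])
      (use graph_finite_edges[OF assms(1)] in \<open>auto simp: matching_def\<close>)
  have "M \<in> {M'. matching E M' \<and> M \<subseteq> M'}" using assms(2) by simp
  from finite_has_maximal2[OF fin this] show ?thesis
    unfolding maximal_matching_def by (metis (no_types, lifting) mem_Collect_eq order_trans)
qed

section \<open>Equimatchability in terms of free edges, also after deletions\<close>

text \<open>A matching without a free edge is maximal, and a larger matching extends to a maximal
  one of at least its size. So any larger \<open>M'\<close> serves for comparison, and every later
  contradiction is a search for a free edge.\<close>

lemma equimatchable_iff:
  assumes "graph V E"
  shows "equimatchable U E \<longleftrightarrow> (\<forall>M M'. matching E M \<longrightarrow> matching E M' \<longrightarrow> card M < card M' \<longrightarrow>
    (\<exists>e\<in>E. e \<inter> \<Union>M = {}))"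
proof
  assume equi: "equimatchable U E"
  show "\<forall>M M'. matching E M \<longrightarrow> matching E M' \<longrightarrow> card M < card M' \<longrightarrow> (\<exists>e\<in>E. e \<inter> \<Union>M = {})"
  proof (intro allI impI, rule ccontr)
    fix M M' assume M: "matching E M" "matching E M'" "card M < card M'"
      and "\<not> (\<exists>e\<in>E. e \<inter> \<Union>M = {})"
    then have "maximal_matching E M" using matching_maximal_iff[OF assms M(1)] by blast
    moreover obtain M'' where M'': "maximal_matching E M''" "M' \<subseteq> M''"
      using matching_extend[OF assms M(2)] by blast
    ultimately have "card M = card M''" using equi unfolding equimatchable_def by blast
    moreover have "card M' \<le> card M''"
      using M'' matching_finite[OF assms] unfolding maximal_matching_def by (meson card_mono)
    ultimately show False using M(3) by simp
  qed
next
  assume free: "\<forall>M M'. matching E M \<longrightarrow> matching E M' \<longrightarrow> card M < card M' \<longrightarrow>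
    (\<exists>e\<in>E. e \<inter> \<Union>M = {})"
  have "\<not> card M < card M'" if M: "maximal_matching E M" "maximal_matching E M'" for M M'
  proof
    assume less: "card M < card M'"
    have *: "matching E M" "matching E M'" using M unfolding maximal_matching_def by simp_all
    show False using free * less M(1) matching_maximal_iff[OF assms *(1)] by metis
  qed
  then show "equimatchable U E" unfolding equimatchable_def by (meson linorder_neqE_nat)
qed

lemma graph_delete_vertex: "graph V E \<Longrightarrow> graph V (delete_vertex_edges E v)"
  by (erule graph_mono) (auto simp: delete_vertex_edges_def)

lemma equimatchable_delete_vertex_iff:
  assumes "graph V E"
  shows "equimatchable U (delete_vertex_edges E v) \<longleftrightarrow>
    (\<forall>M M'. matching E M \<longrightarrow> matching E M' \<longrightarrow> v \<notin> \<Union>M \<longrightarrow> v \<notin> \<Union>M' \<longrightarrow> card M < card M' \<longrightarrow>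
      (\<exists>e\<in>E. v \<notin> e \<and> e \<inter> \<Union>M = {}))"
proof -
  have "(\<exists>e\<in>delete_vertex_edges E v. e \<inter> \<Union>M = {}) \<longleftrightarrow> (\<exists>e\<in>E. v \<notin> e \<and> e \<inter> \<Union>M = {})" for M
    unfolding delete_vertex_edges_def by blast
  then show ?thesis
    unfolding equimatchable_iff[OF graph_delete_vertex[OF assms]] matching_delete_vertex by metis
qed

lemma equimatchable_delete_edge_iff:
  assumes "graph V E"
  shows "equimatchable U (E - {f}) \<longleftrightarrow>
    (\<forall>M M'. matching E M \<longrightarrow> matching E M' \<longrightarrow> f \<notin> M \<longrightarrow> f \<notin> M' \<longrightarrow> card M < card M' \<longrightarrow>
      (\<exists>e\<in>E. e \<noteq> f \<and> e \<inter> \<Union>M = {}))"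
proof -
  have "(\<exists>e\<in>E - {f}. e \<inter> \<Union>M = {}) \<longleftrightarrow> (\<exists>e\<in>E. e \<noteq> f \<and> e \<inter> \<Union>M = {})" for M
    by blast
  then show ?thesis
    unfolding equimatchable_iff[OF graph_mono[OF assms Diff_subset]] matching_delete_edge by metis
qed

section \<open>Counting covered vertices and augmenting matchings\<close>

lemma card_Union_matching:
  assumes "graph V E" "matching E M"
  shows "card (\<Union>M) = 2 * card M"
proof -
  have "card (\<Union>M) = (\<Sum>e\<in>M. card e)"
    by (rule card_Union_disjoint)
      (use assms in \<open>auto simp: graph_def matching_def pairwise_def disjnt_def intro: finite_subset\<close>)
  also have "\<dots> = (\<Sum>e\<in>M. 2)"
    by (rule sum.cong) (use assms in \<open>auto simp: graph_def matching_def\<close>)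
  finally show ?thesis by simp
qed

text \<open>A matching covers twice as many vertices as it has edges, so \<open>M'\<close> covers a
  vertex that \<open>M\<close> misses.\<close>

lemma larger_matching_edge:
  assumes G: "graph V E" and M: "matching E M" and M': "matching E M'" and less: "card M < card M'"
  obtains x y where "{x, y} \<in> M'" "x \<notin> \<Union>M" "x \<noteq> y"
proof -
  have "finite (\<Union>M)"
    by (rule finite_subset[of _ V]) (use G M in \<open>auto simp: graph_def matching_def\<close>)
  then have "\<not> \<Union>M' \<subseteq> \<Union>M"
    using card_mono[of "\<Union>M" "\<Union>M'"] card_Union_matching[OF G M] card_Union_matching[OF G M'] less
    by linarith
  then obtain x e where x: "x \<in> e" "e \<in> M'" "x \<notin> \<Union>M" by blast
  then have "e \<in> E" using M' unfolding matching_def by blast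
  with x(1) obtain y where "e = {x, y}" "x \<noteq> y" using graph_edge_other[OF G] by metis
  with x that show thesis by blast
qed

lemma matching_Diff_Union: "matching E M \<Longrightarrow> e \<in> M \<Longrightarrow> \<Union>(M - {e}) = \<Union>M - e"
  unfolding matching_def by blast

text \<open>Augmentation by induction instead of symmetric differences. If the edge
  \<open>{x, y}\<close> of \<open>M'\<close> with \<open>x\<close> missed by \<open>M\<close> cannot
  be added, then \<open>M\<close> has an edge \<open>f = {y, y'}\<close>. Removing \<open>f\<close>
  from \<open>M\<close> and \<open>{x, y}\<close> from \<open>M'\<close> and augmenting gives
  \<open>N\<close> missing \<open>x\<close> and \<open>y\<close>. If \<open>N\<close> covers
  \<open>y'\<close>, then \<open>{x, y}\<close> can be added, otherwise \<open>f\<close>; either way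
  all of \<open>\<Union>M\<close> is covered again.\<close>

lemma matching_augment:
  assumes "graph V E" "matching E M" "matching E M'" "card M < card M'"
  shows "\<exists>N. matching E N \<and> N \<subseteq> M \<union> M' \<and> card N = Suc (card M) \<and> \<Union>M \<subseteq> \<Union>N"
  using assms(2-)
proof (induction "card M" arbitrary: M M' rule: less_induct)
  case less
  note G = assms(1) and M = less.prems(1) and M' = less.prems(2)
  obtain x y where xy: "{x, y} \<in> M'" "x \<notin> \<Union>M" "x \<noteq> y"
    using larger_matching_edge[OF G less.prems] .
  then have xyE: "{x, y} \<in> E" using M' unfolding matching_def by blast
  show ?case
  proof (cases "y \<in> \<Union>M")
    case False
    then have "{x, y} \<inter> \<Union>M = {}" using xy by blast
    with matching_insert[OF M xyE] card_matching_insert[OF G M xyE] xy(1) show ?thesis by blast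
  next
    case True
    then obtain f where f: "f \<in> M" "y \<in> f" by blast
    then have fE: "f \<in> E" using M unfolding matching_def by blast
    then obtain y' where y': "f = {y, y'}" "y \<noteq> y'" using graph_edge_other[OF G _ f(2)] by metis
    have cards: "card (M - {f}) < card M" "card M = Suc (card (M - {f}))"
      "card (M - {f}) < card (M' - {{x, y}})"
      using less.prems(3) card_Suc_Diff1[OF matching_finite[OF G M] f(1)]
        card_Suc_Diff1[OF matching_finite[OF G M'] xy(1)] by linarith+
    obtain N where N: "matching E N" "N \<subseteq> (M - {f}) \<union> (M' - {{x, y}})"
      "card N = card M" "\<Union>(M - {f}) \<subseteq> \<Union>N"
      using less.hyps[OF cards(1) _ _ cards(3)] matching_subset[OF M, of "M - {f}"]
        matching_subset[OF M', of "M' - {{x, y}}"] cards(2) by auto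
    have "\<Union>N \<subseteq> (\<Union>M - f) \<union> (\<Union>M' - {x, y})"
      using N(2) matching_Diff_Union[OF M f(1)] matching_Diff_Union[OF M' xy(1)] by blast
    then have xyN: "x \<notin> \<Union>N" "y \<notin> \<Union>N" using xy(2) f(2) by blast+
    have cover: "\<Union>M - f \<subseteq> \<Union>N" using N(4) matching_Diff_Union[OF M f(1)] by simp
    show ?thesis
    proof (cases "y' \<in> \<Union>N")
      case True
      have free: "{x, y} \<inter> \<Union>N = {}" using xyN by blast
      have "\<Union>M \<subseteq> \<Union>(insert {x, y} N)" using cover True y'(1) by auto
      then show ?thesis
        using matching_insert[OF N(1) xyE free] card_matching_insert[OF G N(1) xyE free] N(2,3) xy(1)
        by (intro exI[of _ "insert {x, y} N"]) auto
    next
      case False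
      then have free: "f \<inter> \<Union>N = {}" using xyN y'(1) by blast
      have "\<Union>M \<subseteq> \<Union>(insert f N)" using cover by auto
      then show ?thesis
        using matching_insert[OF N(1) fE free] card_matching_insert[OF G N(1) fE free] N(2,3) f(1)
        by (intro exI[of _ "insert f N"]) auto
    qed
  qed
qed

section \<open>Graphs in which every four-vertex path, chords allowed, closes up\<close>

definition p4_closed :: "'a set set \<Rightarrow> bool" where
  "p4_closed E \<longleftrightarrow> (\<forall>a x y b. distinct [a, x, y, b] \<longrightarrow> {a, x} \<in> E \<longrightarrow> {x, y} \<in> E \<longrightarrow> {y, b} \<in> E \<longrightarrow>
     {a, b} \<in> E)"

lemma p4_closedD:
  "p4_closed E \<Longrightarrow> {a, x} \<in> E \<Longrightarrow> {x, y} \<in> E \<Longrightarrow> {y, b} \<in> E \<Longrightarrow> distinct [a, x, y, b] \<Longrightarrow> {a, b} \<in> E"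
  unfolding p4_closed_def by blast

lemma p4_closed_delete_vertex:
  assumes "p4_closed E"
  shows "p4_closed (delete_vertex_edges E v)"
proof -
  have edge: "{s, t} \<in> delete_vertex_edges E v \<longleftrightarrow> {s, t} \<in> E \<and> v \<noteq> s \<and> v \<noteq> t" for s t
    unfolding delete_vertex_edges_def by simp
  show ?thesis
    unfolding p4_closed_def edge using p4_closedD[OF assms] by metis
qed

text \<open>Induction on \<open>M\<close>, removing \<open>x\<close> and \<open>y\<close> from the
  graph and their edges from \<open>M\<close> and \<open>M'\<close>. The free edge \<open>e\<close>
  found there may fail to be free for \<open>M\<close> only by containing \<open>y'\<close>, the
  partner of \<open>y\<close>. Then \<open>e = {y', q}\<close>, the path \<open>q y' y x\<close>
  closes up, and \<open>{q, x}\<close> is free.\<close>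

lemma p4_closed_free_edge:
  assumes "graph V E" "p4_closed E" "matching E M" "matching E M'" "card M < card M'"
  shows "\<exists>e\<in>E. e \<inter> \<Union>M = {}"
  using assms
proof (induction "card M" arbitrary: E M M' rule: less_induct)
  case less
  note G = less.prems(1) and P = less.prems(2) and M = less.prems(3) and M' = less.prems(4)
  obtain x y where xy: "{x, y} \<in> M'" "x \<notin> \<Union>M" "x \<noteq> y"
    using larger_matching_edge[OF G M M' less.prems(5)] .
  then have xyE: "{x, y} \<in> E" using M' unfolding matching_def by blast
  show ?case
  proof (cases "y \<in> \<Union>M")
    case False
    then have "{x, y} \<inter> \<Union>M = {}" using xy(2) by simp
    then show ?thesis using xyE by (rule bexI)
  next
    case True
    then obtain f where f: "f \<in> M" "y \<in> f" by blast
    then have fE: "f \<in> E" using M unfolding matching_def by blast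
    then obtain y' where y': "f = {y, y'}" "y \<noteq> y'" using graph_edge_other[OF G _ f(2)] by metis
    have y'x: "y' \<noteq> x" using f(1) y'(1) xy(2) by blast
    let ?F = "delete_vertex_edges (delete_vertex_edges E x) y"
    have cards: "card (M - {f}) < card M" "card (M - {f}) < card (M' - {{x, y}})"
      using less.prems(5) card_Suc_Diff1[OF matching_finite[OF G M] f(1)]
        card_Suc_Diff1[OF matching_finite[OF G M'] xy(1)] by linarith+
    have "\<exists>e\<in>?F. e \<inter> \<Union>(M - {f}) = {}"
    proof (rule less.hyps[OF cards(1) _ _ _ _ cards(2)])
      show "matching ?F (M - {f})"
        using matching_subset[OF M, of "M - {f}"] matching_Diff_Union[OF M f(1)] f(2) xy(2)
        unfolding matching_delete_vertex by auto
      show "matching ?F (M' - {{x, y}})"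
        using matching_subset[OF M', of "M' - {{x, y}}"] matching_Diff_Union[OF M' xy(1)]
        unfolding matching_delete_vertex by auto
      show "graph V ?F" by (intro graph_delete_vertex G)
      show "p4_closed ?F" by (intro p4_closed_delete_vertex P)
    qed
    then obtain e where e: "e \<in> E" "x \<notin> e" "y \<notin> e" "e \<inter> (\<Union>M - f) = {}"
      using matching_Diff_Union[OF M f(1)] unfolding delete_vertex_edges_def by auto
    show ?thesis
    proof (cases "y' \<in> e")
      case False
      then have "e \<inter> \<Union>M = {}" using e(3,4) y'(1) by blast
      then show ?thesis using e(1) by (rule bexI)
    next
      case True
      then obtain q where q: "e = {y', q}" "y' \<noteq> q" using graph_edge_other[OF G e(1)] by metis
      have "{q, x} \<in> E"
      proof (rule p4_closedD[OF P])
        show "{q, y'} \<in> E" using e(1) q(1) by (simp add: insert_commute)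
        show "{y', y} \<in> E" using fE y'(1) by (simp add: insert_commute)
        show "{y, x} \<in> E" using xyE by (rule edge_sym)
        show "distinct [q, y', y, x]" using q y'(2) y'x e(2,3) xy(3) by auto
      qed
      moreover have "q \<notin> f" using q y'(1) e(3) by simp blast
      then have "q \<notin> \<Union>M" using e(4) q(1) by blast
      then have "{q, x} \<inter> \<Union>M = {}" using xy(2) by simp
      ultimately show ?thesis by (rule bexI[rotated])
    qed
  qed
qed

lemma p4_closed_vertex_stable:
  assumes "graph V E" "p4_closed E"
  shows "vertex_stable_equimatchable V E"
proof -
  have "equimatchable U F" if "graph V F" "p4_closed F" for U and F :: "'a set set"
    unfolding equimatchable_iff[OF that(1)] using p4_closed_free_edge[OF that] by blast
  then show ?thesis
    using assms graph_delete_vertex[OF assms(1)] p4_closed_delete_vertex[OF assms(2)]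
    unfolding vertex_stable_equimatchable_def by blast
qed

lemma complete_p4_closed: "graph V E \<Longrightarrow> complete_graph V E \<Longrightarrow> p4_closed E"
  unfolding complete_graph_def p4_closed_def using graph_edge by (metis distinct_length_2_or_more)

text \<open>A path with three edges has its ends on opposite sides.\<close>

lemma complete_bipartite_p4_closed:
  assumes "complete_bipartite V E"
  shows "p4_closed E"
proof -
  obtain A B where AB: "A \<inter> B = {}" and E: "E = {{a, b} | a b. a \<in> A \<and> b \<in> B}"
    using assms unfolding complete_bipartite_def by blast
  have edge: "{u, v} \<in> E \<longleftrightarrow> u \<in> A \<and> v \<in> B \<or> u \<in> B \<and> v \<in> A" for u v
    unfolding E by (auto simp: doubleton_eq_iff)
  show ?thesis unfolding p4_closed_def edge using AB by blast
qed

lemma connected_closed: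
  assumes "connected V E" "u \<in> V" "v \<in> V" "P u"
    and step: "\<And>p q. P p \<Longrightarrow> {p, q} \<in> E \<Longrightarrow> P q"
  shows "P v"
proof -
  have "(adj E)\<^sup>*\<^sup>* u v" using assms unfolding connected_def by blast
  then show ?thesis by induction (use assms(4) step in \<open>auto simp: adj_def\<close>)
qed

text \<open>Adjacency to the whole triangle spreads along edges: if \<open>v\<close> has it and
  \<open>w\<close> is a neighbour of \<open>v\<close>, the path \<open>w v s t\<close> through a
  suitable triangle vertex \<open>s\<close> closes to \<open>{w, t}\<close>. Two vertices
  \<open>u\<close>, \<open>v\<close> off the triangle are then joined because \<open>u p q v\<close>
  closes up.\<close>

lemma p4_closed_triangle_complete:
  assumes G: "graph V E" and C: "connected V E" and P: "p4_closed E"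
    and T: "{p, q} \<in> E" "{q, r} \<in> E" "{p, r} \<in> E"
  shows "complete_graph V E"
proof -
  note ne = graph_edge[OF G]
  define T where "T = {p, q, r}"
  have tri: "{s, t} \<in> E" if "s \<in> T" "t \<in> T" "s \<noteq> t" for s t
    using that T unfolding T_def by (auto simp: insert_commute)
  \<comment> \<open>Since \<open>v\<close> may itself lie on the triangle, \<open>s\<close> has to
    avoid both \<open>t\<close> and \<open>v\<close>; three vertices suffice.\<close>
  have two: "\<exists>t\<in>T. t \<noteq> s \<and> t \<noteq> s'" for s s'
    using ne[OF T(1)] ne[OF T(2)] ne[OF T(3)] unfolding T_def by auto
  let ?P = "\<lambda>v. \<forall>t\<in>T. t \<noteq> v \<longrightarrow> {v, t} \<in> E"
  have step: "?P w" if v: "?P v" and vw: "{v, w} \<in> E" for v w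
  proof (intro ballI impI)
    fix t assume t: "t \<in> T" "t \<noteq> w"
    consider "v = t" | "w \<in> T" | "v \<noteq> t" "w \<notin> T" by blast
    then show "{w, t} \<in> E"
    proof cases
      case 1
      then show ?thesis using edge_sym[OF vw] by simp
    next
      case 2
      then show ?thesis using tri t by metis
    next
      case 3
      obtain s where s: "s \<in> T" "s \<noteq> t" "s \<noteq> v" using two by blast
      have "distinct [w, v, s, t]" using s t 3 ne[OF vw] by auto
      then show ?thesis
        using p4_closedD[OF P edge_sym[OF vw]] v s(1,3) tri[OF s(1) t(1) s(2)] by blast
    qed
  qed
  have pT: "p \<in> T" "q \<in> T" "p \<noteq> q" "p \<in> V" using ne[OF T(1)] unfolding T_def by simp_all
  have "?P p" using tri pT(1) by blast
  then have all: "?P v" if "v \<in> V" for v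
    using connected_closed[OF C pT(4) that, of ?P] step by blast
  show ?thesis unfolding complete_graph_def
  proof (intro ballI impI)
    fix u v assume uv: "u \<in> V" "v \<in> V" "u \<noteq> v"
    consider "v \<in> T" | "u \<in> T" | "u \<notin> T" "v \<notin> T" by blast
    then show "{u, v} \<in> E"
    proof cases
      case 1
      then show ?thesis using all[OF uv(1)] uv(3) by metis
    next
      case 2
      then show ?thesis using all[OF uv(2)] uv(3) edge_sym by metis
    next
      case 3
      then have "{u, p} \<in> E" "{q, v} \<in> E" "distinct [u, p, q, v]"
        using all[OF uv(1)] all[OF uv(2)] pT edge_sym[of v q E] uv(3) by auto
      then show ?thesis using p4_closedD[OF P _ T(1)] by blast
    qed
  qed
qed

text \<open>Without a triangle, the sides are the neighbourhoods of the ends of one edge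
  \<open>{a, b}\<close>; they are disjoint as there is no triangle. Closing \<open>u b a v\<close>
  gives all edges between them, closing \<open>v u b a\<close> and \<open>v u a b\<close> keeps
  neighbours on the opposite side, and connectedness reaches every vertex.\<close>

lemma p4_closed_connected_cases:
  assumes G: "graph V E" and C: "connected V E" and P: "p4_closed E"
  shows "complete_graph V E \<or> complete_bipartite V E"
proof (rule disjCI)
  assume nbip: "\<not> complete_bipartite V E"
  note ne = graph_edge[OF G]
  show "complete_graph V E"
  proof (cases "\<exists>p q r. {p, q} \<in> E \<and> {q, r} \<in> E \<and> {p, r} \<in> E")
    case True
    then show ?thesis using p4_closed_triangle_complete[OF G C P] by blast
  next
    case no_tri: False
    \<comment> \<open>Any edge would make the graph complete bipartite, so only the one-vertex graph
      remains, which is complete.\<close>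
    have "E = {}"
    proof (rule ccontr)
      assume "E \<noteq> {}"
      then obtain a b where ab: "{a, b} \<in> E" by (metis G all_not_in_conv graph_edge_cases)
      define A B where "A = {u. {u, b} \<in> E}" and "B = {v. {a, v} \<in> E}"
      have A: "u \<in> A \<longleftrightarrow> {u, b} \<in> E" for u unfolding A_def by simp
      have B: "v \<in> B \<longleftrightarrow> {a, v} \<in> E" for v unfolding B_def by simp
      have aA: "a \<in> A" "b \<in> B" using ab A B by simp_all
      have disj: "A \<inter> B = {}"
      proof (rule ccontr)
        assume "A \<inter> B \<noteq> {}"
        then obtain u where "{u, b} \<in> E" "{a, u} \<in> E" using A B by blast
        then show False using no_tri ab by blast
      qed
      have cross: "{u, v} \<in> E" if "u \<in> A" "v \<in> B" for u v
      proof -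
        consider "u = a" | "v = b" | "u \<noteq> a" "v \<noteq> b" by blast
        then show ?thesis
        proof cases
          case 3
          have "u \<noteq> v" "u \<noteq> b" "v \<noteq> a" using that disj aA by blast+
          then have "distinct [u, b, a, v]" using 3 ne[OF ab] by auto
          then show ?thesis using p4_closedD[OF P _ edge_sym[OF ab]] that A B by blast
        qed (use that A B in auto)
      qed
      have opp: "v \<in> B" if "u \<in> A" "{u, v} \<in> E" for u v
      proof -
        consider "u = a" | "v = b" | "u \<noteq> a" "v \<noteq> b" by blast
        then show ?thesis
        proof cases
          case 3
          have "u \<noteq> b" "v \<noteq> a" using that disj aA no_tri A edge_sym[of a b E] by blast+
          then have "distinct [v, u, b, a]" using 3 ne[OF ab] ne[OF that(2)] by auto
          then have "{v, a} \<in> E"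
            using p4_closedD[OF P edge_sym[OF that(2)] _ edge_sym[OF ab]] that(1) A by blast
          then show ?thesis using B by (simp add: insert_commute)
        qed (use that B aA in auto)
      qed
      have opp': "v \<in> A" if "u \<in> B" "{u, v} \<in> E" for u v
      proof -
        consider "u = b" | "v = a" | "u \<noteq> b" "v \<noteq> a" by blast
        then show ?thesis
        proof cases
          case 1
          then show ?thesis using that(2) A by (simp add: insert_commute)
        next
          case 3
          have "v \<noteq> b"
            using that no_tri B ab by blast
          moreover have "u \<noteq> a" using that(1) disj aA by blast
          ultimately have "distinct [v, u, a, b]" using 3 ne[OF ab] ne[OF that(2)] by auto
          moreover have "{u, a} \<in> E" using that(1) B by (simp add: insert_commute)
          ultimately show ?thesis
            using p4_closedD[OF P edge_sym[OF that(2)] _ ab] A by blast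
        qed (use aA in auto)
      qed
      have AB: "v \<in> A \<union> B" if "v \<in> V" for v
        using connected_closed[OF C, of a v "\<lambda>v. v \<in> A \<union> B"] that ne[OF ab] aA opp opp' by blast
      then have V: "A \<union> B = V" using ne A B by blast
      have "e \<in> {{u, v} | u v. u \<in> A \<and> v \<in> B}" if eE: "e \<in> E" for e
      proof -
        obtain u v where e: "e = {u, v}" "u \<in> V" using graph_edge_cases[OF G eE] by metis
        then have uv: "{u, v} \<in> E" using eE by simp
        from AB[OF e(2)] show ?thesis
        proof
          assume "u \<in> A"
          then show ?thesis using opp[OF _ uv] e(1) by blast
        next
          assume "u \<in> B"
          moreover have "e = {v, u}" using e(1) by (rule trans[OF _ insert_commute])
          ultimately show ?thesis using opp'[OF _ uv] by blast
        qed
      qed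
      moreover have "e \<in> E" if "e \<in> {{u, v} | u v. u \<in> A \<and> v \<in> B}" for e
        using that cross by blast
      ultimately have "E = {{u, v} | u v. u \<in> A \<and> v \<in> B}" by blast
      then have "complete_bipartite V E"
        using V disj aA unfolding complete_bipartite_def by blast
      with nbip show False by blast
    qed
    have "u = v" if "u \<in> V" "v \<in> V" for u v
      by (rule connected_closed[OF C that, of "\<lambda>w. u = w"]) (simp_all add: \<open>E = {}\<close>)
    then show ?thesis unfolding complete_graph_def by blast
  qed
qed


section \<open>Open four-vertex paths and vertices missed by maximum matchings\<close>

text \<open>A witness against \<open>p4_closed\<close>. The chords \<open>{a, y}\<close> and
  \<open>{x, b}\<close> are allowed here; \<open>open_p4_alternates\<close> excludes them under
  vertex-stability.\<close>

definition open_p4 :: "'a set set \<Rightarrow> 'a \<Rightarrow> 'a \<Rightarrow> 'a \<Rightarrow> 'a \<Rightarrow> bool" where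
  "open_p4 E a x y b \<longleftrightarrow>
     distinct [a, x, y, b] \<and> {a, x} \<in> E \<and> {x, y} \<in> E \<and> {y, b} \<in> E \<and> {a, b} \<notin> E"

text \<open>The set \<open>D\<close> of the Gallai-Edmonds decomposition.\<close>

definition exposable :: "'a set \<Rightarrow> 'a set set \<Rightarrow> 'a set" where
  "exposable V E =
     {v \<in> V. \<exists>M. matching E M \<and> v \<notin> \<Union>M \<and> (\<forall>M'. matching E M' \<longrightarrow> card M' \<le> card M)}"

lemma open_p4_rev: "open_p4 E a x y b \<Longrightarrow> open_p4 E b y x a"
  unfolding open_p4_def by (simp add: insert_commute) blast

lemma matching_add1:
  assumes "graph V E" "matching E N" "{p, q} \<in> E" "p \<notin> \<Union>N" "q \<notin> \<Union>N"
  shows "\<exists>M. matching E M \<and> card M = Suc (card N) \<and> \<Union>M = {p, q} \<union> \<Union>N"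
proof -
  have "{p, q} \<inter> \<Union>N = {}" using assms(4,5) by simp
  from matching_insert[OF assms(2,3) this] card_matching_insert[OF assms(1-3) this]
  show ?thesis by (intro exI[of _ "insert {p, q} N"]) simp
qed

lemma matching_add2:
  assumes "graph V E" "matching E N" "{p, q} \<in> E" "{r, s} \<in> E" "distinct [p, q, r, s]"
    "p \<notin> \<Union>N" "q \<notin> \<Union>N" "r \<notin> \<Union>N" "s \<notin> \<Union>N"
  shows "\<exists>M. matching E M \<and> card M = Suc (Suc (card N)) \<and> \<Union>M = {p, q, r, s} \<union> \<Union>N"
proof -
  obtain M where M: "matching E M" "card M = Suc (card N)" "\<Union>M = {p, q} \<union> \<Union>N"
    using matching_add1[OF assms(1-3,6,7)] by blast
  have "r \<notin> \<Union>M" "s \<notin> \<Union>M" using M(3) assms(5,8,9) by auto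
  from matching_add1[OF assms(1) M(1) assms(4) this] obtain M' where
    "matching E M'" "card M' = Suc (card M)" "\<Union>M' = {r, s} \<union> \<Union>M" by blast
  then show ?thesis using M(2,3) by (intro exI[of _ M']) auto
qed

text \<open>
  With \<open>I\<close> the set of vertices outside the path and \<open>N\<close>, the argument finds two neighbours of \<open>b\<close>
  in \<open>I\<close>; then \<open>a\<close> and \<open>y\<close> have none, since three disjoint edges could otherwise be added to \<open>N\<close>.
\<close>

lemma open_p4_oriented:
  assumes G: "graph V E" and S: "vertex_stable_equimatchable V E" and P: "open_p4 E a x y b"
    and N: "matching E N" "{a, x, y, b} \<inter> \<Union>N = {}"
    and maxN: "\<And>p q. {p, q} \<in> E \<Longrightarrow> p \<notin> \<Union>N \<Longrightarrow> q \<notin> \<Union>N \<Longrightarrow> p \<in> {a, x, y, b} \<or> q \<in> {a, x, y, b}"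
    and z: "{b, z} \<in> E" "z \<notin> \<Union>N" "z \<noteq> x" "z \<noteq> y"
  shows "{a, y} \<notin> E \<and> {x, b} \<notin> E \<and>
    a \<in> exposable V E \<and> y \<in> exposable V E \<and> x \<notin> exposable V E \<and> b \<notin> exposable V E"
proof -
  have edges: "{a, x} \<in> E" "{x, y} \<in> E" "{y, b} \<in> E" "{a, b} \<notin> E"
    and neq: "a \<noteq> x" "a \<noteq> y" "a \<noteq> b" "x \<noteq> y" "x \<noteq> b" "y \<noteq> b"
    using P unfolding open_p4_def by auto
  have out: "a \<notin> \<Union>N" "x \<notin> \<Union>N" "y \<notin> \<Union>N" "b \<notin> \<Union>N" using N(2) by auto
  have inV: "a \<in> V" "x \<in> V" "y \<in> V" "b \<in> V" "z \<in> V"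
    using graph_edge[OF G edges(1)] graph_edge[OF G edges(3)] graph_edge[OF G z(1)] by simp_all
  have za: "z \<noteq> a" using z(1) edges(4) by (auto simp: insert_commute)
  have zb: "z \<noteq> b" using graph_edge[OF G z(1)] by auto
  note z = z za zb
  \<comment> \<open>\<open>K\<close> is the part of the path and its surroundings covered in
    addition to \<open>N\<close>. The free edge supplied by equimatchability has an end on the path
    by \<open>maxN\<close>; that end is named \<open>p\<close>.\<close>
  have free: "\<exists>p q. {p, q} \<in> E \<and> p \<in> {a, x, y, b} - K \<and> q \<notin> K \<and> q \<notin> \<Union>N \<and> p \<noteq> q"
    if M: "matching E M" "\<Union>M = K \<union> \<Union>N" "matching E M'" "card M < card M'" for M M' K
  proof -
    have "equimatchable V E" using S unfolding vertex_stable_equimatchable_def by simp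
    then obtain e where e: "e \<in> E" "e \<inter> \<Union>M = {}"
      using equimatchable_iff[OF G] M by meson
    obtain p q where pq: "e = {p, q}" "p \<noteq> q" using graph_edge_cases[OF G e(1)] by metis
    with e have "{p, q} \<in> E" "{q, p} \<in> E" by (simp_all add: insert_commute)
    moreover have "p \<notin> K" "q \<notin> K" "p \<notin> \<Union>N" "q \<notin> \<Union>N" using e(2) pq M(2) by auto
    ultimately show ?thesis using maxN[of p q] pq(2) by (metis DiffI)
  qed
  have free_del: "\<exists>p q. {p, q} \<in> E \<and> p \<in> {a, x, y, b} - K \<and> q \<notin> K \<and> q \<notin> \<Union>N \<and> p \<noteq> q \<and> p \<noteq> v \<and> q \<noteq> v"
    if v: "v \<in> V" "v \<notin> \<Union>M" "v \<notin> \<Union>M'"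
      and M: "matching E M" "\<Union>M = K \<union> \<Union>N" "matching E M'" "card M < card M'" for v M M' K
  proof -
    have "equimatchable (V - {v}) (delete_vertex_edges E v)"
      using S v(1) unfolding vertex_stable_equimatchable_def by blast
    then obtain e where e: "e \<in> E" "v \<notin> e" "e \<inter> \<Union>M = {}"
      using equimatchable_delete_vertex_iff[OF G] M v by meson
    obtain p q where pq: "e = {p, q}" "p \<noteq> q" using graph_edge_cases[OF G e(1)] by metis
    with e have "{p, q} \<in> E" "{q, p} \<in> E" "p \<noteq> v" "q \<noteq> v" by (auto simp: insert_commute)
    moreover have "p \<notin> K" "q \<notin> K" "p \<notin> \<Union>N" "q \<notin> \<Union>N" using e(3) pq M(2) by auto
    ultimately show ?thesis using maxN[of p q] pq(2) by (metis DiffI)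
  qed
  obtain M0 where M0: "matching E M0" "card M0 = Suc (Suc (card N))" "\<Union>M0 = {a, x, y, b} \<union> \<Union>N"
    using matching_add2[OF G N(1) edges(1,3)] neq out by auto
  \<comment> \<open>\<open>M0\<close> covers the whole path, so it leaves no free edge and is
    maximum.\<close>
  have bound: "card M \<le> Suc (Suc (card N))" if "matching E M" for M
  proof (rule ccontr)
    assume "\<not> ?thesis"
    then have "card M0 < card M" using M0(2) by simp
    from free[OF M0(1,3) that this] show False by simp
  qed
  \<comment> \<open>Three disjoint edges missed by \<open>N\<close> would give a matching larger
    than \<open>M0\<close>.\<close>
  have no3: False
    if h: "{p, q} \<in> E" "{r, s} \<in> E" "{t, u} \<in> E" "distinct [p, q, r, s, t, u]"
      "p \<notin> \<Union>N" "q \<notin> \<Union>N" "r \<notin> \<Union>N" "s \<notin> \<Union>N" "t \<notin> \<Union>N" "u \<notin> \<Union>N" for p q r s t u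
  proof -
    obtain M where M: "matching E M" "card M = Suc (Suc (card N))" "\<Union>M = {p, q, r, s} \<union> \<Union>N"
      using matching_add2[OF G N(1) h(1,2)] h(4-8) by auto
    have "t \<notin> {p, q, r, s}" "u \<notin> {p, q, r, s}" using h(4) by auto
    then have "t \<notin> \<Union>M" "u \<notin> \<Union>M" unfolding M(3) using h(9,10) by simp_all
    from matching_add1[OF G M(1) h(3) this] obtain M' where
      "matching E M'" "card M' = Suc (card M)" by blast
    with M(2) bound[of M'] show False by simp
  qed
  obtain Mxy where Mxy: "matching E Mxy" "card Mxy = Suc (card N)" "\<Union>Mxy = {x, y} \<union> \<Union>N"
    using matching_add1[OF G N(1) edges(2)] out by auto
  \<comment> \<open>After deleting \<open>z\<close>, compare \<open>N\<close> plus
    \<open>{x, y}\<close> with \<open>M0\<close>. The free edge starts at \<open>a\<close> or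
    \<open>b\<close>; starting at \<open>a\<close>, it would form three disjoint edges with
    \<open>{x, y}\<close> and \<open>{b, z}\<close>.\<close>
  have "\<exists>z'. {b, z'} \<in> E \<and> z' \<notin> \<Union>N \<and> z' \<notin> {a, x, y, b} \<and> z' \<noteq> z"
  proof -
    have "z \<notin> \<Union>Mxy" "z \<notin> \<Union>M0" using Mxy(3) M0(3) z by auto
    from free_del[OF inV(5) this Mxy(1,3) M0(1)] Mxy(2) M0(2) obtain p q where
      pq: "{p, q} \<in> E" "p \<in> {a, x, y, b} - {x, y}" "q \<notin> {x, y}" "q \<notin> \<Union>N" "p \<noteq> q" "q \<noteq> z"
      by auto
    consider "p = a" | "p = b" using pq(2) by blast
    then show ?thesis
    proof cases
      case 1
      then have "q \<noteq> b" using pq(1) edges(4) by blast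
      then show ?thesis
        using no3[OF edges(2) pq(1) z(1)] 1 pq(3-6) neq out z by auto
    next
      case 2
      then have "q \<noteq> a" using pq(1) edges(4) by (auto simp: insert_commute)
      then show ?thesis using 2 pq by auto
    qed
  qed
  then obtain z' where z': "{b, z'} \<in> E" "z' \<notin> \<Union>N" "z' \<notin> {a, x, y, b}" "z' \<noteq> z" by blast
  \<comment> \<open>Having two outside neighbours, \<open>b\<close> can always be matched outside
    the path while avoiding a given \<open>w\<close>.\<close>
  have spare: "\<exists>t. {b, t} \<in> E \<and> t \<notin> \<Union>N \<and> t \<notin> {a, x, y, b} \<and> t \<noteq> w" for w
    using z z' by (metis empty_iff insert_iff)
  have aI: "{a, w} \<notin> E" if w: "w \<notin> \<Union>N" "w \<noteq> x" "w \<noteq> y" for w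
  proof
    assume aw: "{a, w} \<in> E"
    obtain t where t: "{b, t} \<in> E" "t \<notin> \<Union>N" "t \<notin> {a, x, y, b}" "t \<noteq> w" using spare by blast
    have "w \<noteq> a" "w \<noteq> b" using graph_edge[OF G aw] aw edges(4) by auto
    then show False using no3[OF edges(2) aw t(1)] neq out t w by auto
  qed
  have yI: "{y, w} \<notin> E" if w: "w \<notin> \<Union>N" "w \<noteq> a" "w \<noteq> x" "w \<noteq> b" for w
  proof
    assume yw: "{y, w} \<in> E"
    obtain t where t: "{b, t} \<in> E" "t \<notin> \<Union>N" "t \<notin> {a, x, y, b}" "t \<noteq> w" using spare by blast
    have "w \<noteq> y" using graph_edge[OF G yw] by auto
    then show False using no3[OF edges(1) yw t(1)] neq out t w by auto
  qed
  obtain Myb where Myb: "matching E Myb" "card Myb = Suc (card N)" "\<Union>Myb = {y, b} \<union> \<Union>N"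
    using matching_add1[OF G N(1) edges(3)] out by auto
  obtain Max where Max: "matching E Max" "card Max = Suc (card N)" "\<Union>Max = {a, x} \<union> \<Union>N"
    using matching_add1[OF G N(1) edges(1)] out by auto
  obtain Ma where Ma: "matching E Ma" "card Ma = Suc (Suc (card N))" "\<Union>Ma = {x, y, b, z} \<union> \<Union>N"
    using matching_add2[OF G N(1) edges(2) z(1)] neq out z by auto
  obtain My where My: "matching E My" "card My = Suc (Suc (card N))" "\<Union>My = {a, x, b, z} \<union> \<Union>N"
    using matching_add2[OF G N(1) edges(1) z(1)] neq out z by auto
  \<comment> \<open>Otherwise, deleting \<open>a\<close> and comparing \<open>N\<close> plus
    \<open>{y, b}\<close> with \<open>Ma\<close> gives a free edge \<open>{x, w}\<close>, and
    \<open>{a, y}\<close>, \<open>{x, w}\<close>, \<open>{b, t}\<close> contradict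
    \<open>no3\<close>.\<close>
  have ay: "{a, y} \<notin> E"
  proof
    assume ay: "{a, y} \<in> E"
    have "a \<notin> \<Union>Myb" "a \<notin> \<Union>Ma" using Myb(3) Ma(3) z neq out by auto
    from free_del[OF inV(1) this Myb(1,3) Ma(1)] Myb(2) Ma(2) obtain p w where
      pw: "{p, w} \<in> E" "p \<in> {a, x, y, b} - {y, b}" "w \<notin> {y, b}" "w \<notin> \<Union>N" "p \<noteq> w" "p \<noteq> a" "w \<noteq> a"
      by auto
    then have "p = x" by blast
    with pw have xw: "{x, w} \<in> E" "w \<notin> {a, x, y, b}" by auto
    obtain t where t: "{b, t} \<in> E" "t \<notin> \<Union>N" "t \<notin> {a, x, y, b}" "t \<noteq> w" using spare by blast
    show False using no3[OF ay xw(1) t(1)] xw(2) pw(4) neq out t by auto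
  qed
  \<comment> \<open>Otherwise \<open>N\<close> plus \<open>{x, b}\<close> would leave a free edge at
    \<open>a\<close> or \<open>y\<close>, but \<open>aI\<close>, \<open>yI\<close> and
    \<open>ay\<close> leave these no neighbour for it.\<close>
  have xb: "{x, b} \<notin> E"
  proof
    assume xb: "{x, b} \<in> E"
    obtain M where M: "matching E M" "card M = Suc (card N)" "\<Union>M = {x, b} \<union> \<Union>N"
      using matching_add1[OF G N(1) xb] out by auto
    from free[OF M(1,3) M0(1)] M(2) M0(2) obtain p q where
      pq: "{p, q} \<in> E" "p \<in> {a, x, y, b} - {x, b}" "q \<notin> {x, b}" "q \<notin> \<Union>N" "p \<noteq> q" by auto
    consider "p = a" | "p = y" using pq(2) by blast
    then show False
    proof cases
      case 1
      then show False using aI[of q] ay pq by auto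
    next
      case 2
      then have "q \<noteq> a" using pq(1) ay by (auto simp: insert_commute)
      with 2 show False using yI[of q] pq by auto
    qed
  qed
  have "a \<in> exposable V E"
    unfolding exposable_def using inV(1) Ma bound z neq out by (auto intro!: exI[of _ Ma])
  moreover have "y \<in> exposable V E"
    unfolding exposable_def using inV(3) My bound z neq out by (auto intro!: exI[of _ My])
  \<comment> \<open>If a maximum matching missed \<open>x\<close>, then without \<open>x\<close> the
    smaller \<open>Myb\<close> would leave a free edge, necessarily at \<open>a\<close>, against
    \<open>aI\<close>. The case of \<open>b\<close> is analogous, with \<open>Max\<close>,
    \<open>y\<close> and \<open>yI\<close>.\<close>
  moreover have "x \<notin> exposable V E"
  proof
    assume "x \<in> exposable V E"
    then obtain M where M: "matching E M" "x \<notin> \<Union>M" "card M0 \<le> card M"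
      using M0(1) unfolding exposable_def by blast
    have "x \<notin> \<Union>Myb" using Myb(3) neq out by auto
    from free_del[OF inV(2) this M(2) Myb(1,3) M(1)] Myb(2) M0(2) M(3) obtain p q where
      pq: "{p, q} \<in> E" "p \<in> {a, x, y, b} - {y, b}" "q \<notin> {y, b}" "q \<notin> \<Union>N" "p \<noteq> x" "q \<noteq> x"
      by auto
    then have "p = a" by blast
    then show False using aI[of q] pq by auto
  qed
  moreover have "b \<notin> exposable V E"
  proof
    assume "b \<in> exposable V E"
    then obtain M where M: "matching E M" "b \<notin> \<Union>M" "card M0 \<le> card M"
      using M0(1) unfolding exposable_def by blast
    have "b \<notin> \<Union>Max" using Max(3) neq out by auto
    from free_del[OF inV(4) this M(2) Max(1,3) M(1)] Max(2) M0(2) M(3) obtain p q where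
      pq: "{p, q} \<in> E" "p \<in> {a, x, y, b} - {a, x}" "q \<notin> {a, x}" "q \<notin> \<Union>N" "p \<noteq> b" "q \<noteq> b"
      by auto
    then have "p = y" by blast
    then show False using yI[of q] pq by auto
  qed
  ultimately show ?thesis using ay xb by blast
qed

text \<open>With \<open>N\<close> maximal among the edges off the path, \<open>N\<close> plus
  \<open>{x, y}\<close> is smaller than \<open>N\<close> plus \<open>{a, x}\<close> and
  \<open>{y, b}\<close>, so an edge at \<open>a\<close> or \<open>b\<close> is free. Which end it is
  decides the orientation of the path, and with it which vertices are exposable; the conclusion is
  therefore symmetric under reversal.\<close>

lemma open_p4_alternates:
  assumes G: "graph V E" and S: "vertex_stable_equimatchable V E" and P: "open_p4 E a x y b"
  shows "{a, y} \<notin> E \<and> {x, b} \<notin> E \<and>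
    (a \<in> exposable V E \<longleftrightarrow> x \<notin> exposable V E) \<and>
    (x \<in> exposable V E \<longleftrightarrow> y \<notin> exposable V E) \<and>
    (y \<in> exposable V E \<longleftrightarrow> b \<notin> exposable V E)"
proof -
  have edges: "{a, x} \<in> E" "{x, y} \<in> E" "{y, b} \<in> E" "{a, b} \<notin> E"
    and neq: "a \<noteq> x" "a \<noteq> y" "a \<noteq> b" "x \<noteq> y" "x \<noteq> b" "y \<noteq> b"
    using P unfolding open_p4_def by auto
  let ?K = "{a, x, y, b}"
  let ?F = "{e \<in> E. e \<inter> ?K = {}}"
  have GF: "graph V ?F" by (rule graph_mono[OF G]) auto
  obtain N where N: "maximal_matching ?F N" using matching_extend[OF GF matching_empty] by blast
  then have NF: "matching ?F N" unfolding maximal_matching_def by simp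
  then have NE: "matching E N" and KN: "?K \<inter> \<Union>N = {}" unfolding matching_def by blast+
  have out: "a \<notin> \<Union>N" "x \<notin> \<Union>N" "y \<notin> \<Union>N" "b \<notin> \<Union>N" using KN by auto
  have maxN: "p \<in> ?K \<or> q \<in> ?K" if pq: "{p, q} \<in> E" "p \<notin> \<Union>N" "q \<notin> \<Union>N" for p q
  proof (rule ccontr)
    assume "\<not> ?thesis"
    then have "{p, q} \<in> ?F" using pq(1) by auto
    then have "{p, q} \<inter> \<Union>N \<noteq> {}" using N matching_maximal_iff[OF GF NF] by blast
    then show False using pq(2,3) by simp
  qed
  obtain M0 where M0: "matching E M0" "card M0 = Suc (Suc (card N))"
    using matching_add2[OF G NE edges(1,3)] neq out by auto
  obtain M where M: "matching E M" "card M = Suc (card N)" "\<Union>M = {x, y} \<union> \<Union>N"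
    using matching_add1[OF G NE edges(2)] out by auto
  have "equimatchable V E" using S unfolding vertex_stable_equimatchable_def by simp
  moreover have "card M < card M0" using M0(2) M(2) by simp
  ultimately obtain e where e: "e \<in> E" "e \<inter> \<Union>M = {}"
    using equimatchable_iff[OF G] M(1) M0(1) by meson
  obtain p q where pq: "e = {p, q}" "p \<noteq> q" using graph_edge_cases[OF G e(1)] by metis
  with e have pqE: "{p, q} \<in> E" "{q, p} \<in> E" by (simp_all add: insert_commute)
  have pqN: "p \<notin> {x, y}" "q \<notin> {x, y}" "p \<notin> \<Union>N" "q \<notin> \<Union>N" using e(2) pq(1) M(3) by auto
  have "\<exists>c z. {c, z} \<in> E \<and> (c = a \<or> c = b) \<and> z \<notin> \<Union>N \<and> z \<notin> {x, y}"
    using maxN[OF pqE(1) pqN(3,4)]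
  proof
    assume "p \<in> ?K"
    then show ?thesis using pqE(1) pqN by (intro exI[of _ p] exI[of _ q]) auto
  next
    assume "q \<in> ?K"
    then show ?thesis using pqE(2) pqN by (intro exI[of _ q] exI[of _ p]) auto
  qed
  then obtain c z where z: "{c, z} \<in> E" "c = a \<or> c = b" "z \<notin> \<Union>N" "z \<noteq> x" "z \<noteq> y" by auto
  from z(2) show ?thesis
  proof
    assume "c = a"
    then have "{a, z} \<in> E" using z(1) by simp
    have eq: "{b, y, x, a} = ?K" by auto
    have "{b, x} \<notin> E \<and> {y, a} \<notin> E \<and> b \<in> exposable V E \<and> x \<in> exposable V E \<and>
      y \<notin> exposable V E \<and> a \<notin> exposable V E"
      by (rule open_p4_oriented[OF G S open_p4_rev[OF P] NE, of z])
        (use KN maxN \<open>{a, z} \<in> E\<close> z(3-5) eq in simp_all)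
    then show ?thesis by (simp add: insert_commute)
  next
    assume "c = b"
    then have "{b, z} \<in> E" using z(1) by simp
    from open_p4_oriented[OF G S P NE KN maxN this z(3-5)] show ?thesis by simp
  qed
qed

text \<open>Lying on an open path spreads along edges. A new neighbour \<open>w\<close> of
  \<open>v\<close> either replaces a neighbour of \<open>v\<close> on the path or is put in front of
  \<open>v\<close> as a new end, depending on whether \<open>w\<close> is adjacent to the vertex two
  steps from \<open>v\<close>. In each case \<open>v\<close> and \<open>w\<close> are consecutive on
  an open path, where exposability alternates.\<close>

lemma exposable_alternates:
  assumes G: "graph V E" and C: "connected V E" and S: "vertex_stable_equimatchable V E"
    and np: "\<not> p4_closed E" and pq: "{p, q} \<in> E"
  shows "p \<in> exposable V E \<longleftrightarrow> q \<notin> exposable V E"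
proof -
  let ?D = "exposable V E"
  let ?on = "\<lambda>v. \<exists>a x y b. open_p4 E a x y b \<and> v \<in> {a, x, y, b}"
  have step: "?on w \<and> (v \<in> ?D \<longleftrightarrow> w \<notin> ?D)" if v: "?on v" and vw: "{v, w} \<in> E" for v w
  proof -
    have ends: ?thesis if O: "open_p4 E v x y b" for x y b
    proof -
      note alt = open_p4_alternates[OF G S]
      have E: "{v, x} \<in> E" "{x, y} \<in> E" "{y, b} \<in> E" "{v, b} \<notin> E" "distinct [v, x, y, b]"
        using O unfolding open_p4_def by simp_all
      have vy: "{v, y} \<notin> E" using alt[OF O] by simp
      show ?thesis
      proof (cases "w = x")
        case True
        then show ?thesis using alt[OF O] O by blast
      next
        case False
        have w: "w \<noteq> v" "w \<noteq> x" "w \<noteq> y" "w \<noteq> b" using False vw vy E(4) graph_edge[OF G vw] by auto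
        show ?thesis
        proof (cases "{w, y} \<in> E")
          case True
          then have "open_p4 E v w y b" using E vw w unfolding open_p4_def by auto
          then show ?thesis using alt by blast
        next
          case False
          then have "open_p4 E w v x y" using E edge_sym[OF vw] w unfolding open_p4_def by auto
          then show ?thesis using alt by blast
        qed
      qed
    qed
    have mids: ?thesis if O: "open_p4 E a v y b" for a y b
    proof -
      note alt = open_p4_alternates[OF G S]
      have E: "{a, v} \<in> E" "{v, y} \<in> E" "{y, b} \<in> E" "{a, b} \<notin> E" "distinct [a, v, y, b]"
        using O unfolding open_p4_def by simp_all
      have vb: "{v, b} \<notin> E" using alt[OF O] by simp
      show ?thesis
      proof (cases "w = a \<or> w = y")
        case True
        then show ?thesis using alt[OF O] O by blast
      next
        case False
        have w: "w \<noteq> v" "w \<noteq> a" "w \<noteq> y" "w \<noteq> b" using False vw vb graph_edge[OF G vw] by auto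
        show ?thesis
        proof (cases "{w, b} \<in> E")
          case True
          then have "open_p4 E a v w b" using E vw w unfolding open_p4_def by auto
          then show ?thesis using alt by blast
        next
          case False
          then have "open_p4 E w v y b" using E edge_sym[OF vw] w unfolding open_p4_def by auto
          then show ?thesis using alt by blast
        qed
      qed
    qed
    obtain a x y b where O: "open_p4 E a x y b" "v \<in> {a, x, y, b}" using v by blast
    consider "v = a" | "v = x" | "v = y" | "v = b" using O(2) by blast
    then show ?thesis
      \<comment> \<open>Reversing the path reduces the four positions of \<open>v\<close> to an end
        and its inner neighbour.\<close>
      using ends[of x y b] mids[of a y b] mids[of b x a] ends[of y x a] O(1) open_p4_rev[OF O(1)]
      by cases simp_all
  qed
  obtain a x y b where O: "open_p4 E a x y b"
    using np unfolding p4_closed_def open_p4_def by blast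
  then have "{a, x} \<in> E" unfolding open_p4_def by simp
  then have "a \<in> V" "p \<in> V" using graph_edge[OF G] pq by blast+
  moreover have "?on a" using O by blast
  ultimately have "?on p" using connected_closed[OF C, of a p ?on] step by blast
  from step[OF this pq] show ?thesis by simp
qed

section \<open>Passing between vertex-stability and edge-stability\<close>

lemma vertex_stable_edge_stable:
  assumes G: "graph V E" and S: "vertex_stable_equimatchable V E"
    and D: "\<And>e. e \<in> E \<Longrightarrow> e \<inter> exposable V E \<noteq> {}"
  shows "edge_stable_equimatchable V E"
proof -
  have eq: "equimatchable V E" using S unfolding vertex_stable_equimatchable_def by simp
  have "equimatchable V (E - {f})" if fE: "f \<in> E" for f
    unfolding equimatchable_delete_edge_iff[OF G]
  proof (intro allI impI, rule ccontr)
    fix M M' assume M: "matching E M" "matching E M'" "card M < card M'"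
      and no: "\<not> (\<exists>e\<in>E. e \<noteq> f \<and> e \<inter> \<Union>M = {})"
    \<comment> \<open>Equimatchability of the whole graph yields a free edge, which can only be the
      deleted edge \<open>f\<close>.\<close>
    obtain e where "e \<in> E" "e \<inter> \<Union>M = {}" using eq equimatchable_iff[OF G] M by meson
    then have f: "f \<inter> \<Union>M = {}" using no by blast
    obtain d where d: "d \<in> f" "d \<in> exposable V E" using D[OF fE] by blast
    \<comment> \<open>A maximum matching missing \<open>d\<close> survives the deletion of
      \<open>d\<close>, whereas the only free edge \<open>f\<close> does not.\<close>
    then obtain Md where Md: "matching E Md" "d \<notin> \<Union>Md" "card M' \<le> card Md" "d \<in> V"
      using M(2) unfolding exposable_def by blast
    have "equimatchable (V - {d}) (delete_vertex_edges E d)"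
      using S Md(4) unfolding vertex_stable_equimatchable_def by blast
    moreover have "d \<notin> \<Union>M" "card M < card Md" using d(1) f M(3) Md(3) by auto
    ultimately obtain e where "e \<in> E" "d \<notin> e" "e \<inter> \<Union>M = {}"
      using equimatchable_delete_vertex_iff[OF G] M(1) Md(1,2) by meson
    then show False using no d(1) by blast
  qed
  with eq show ?thesis unfolding edge_stable_equimatchable_def by blast
qed

lemma card_matching_side:
  assumes "graph V E" "matching E M" and AB: "A \<inter> B = {}" "\<forall>e\<in>E. \<exists>a\<in>A. \<exists>b\<in>B. e = {a, b}"
  shows "card (\<Union>M \<inter> A) = card M"
proof -
  have one: "card (e \<inter> A) = 1" if "e \<in> M" for e
  proof -
    have "e \<in> E" using that assms(2) unfolding matching_def by blast
    then obtain a b where "a \<in> A" "b \<in> B" "e = {a, b}" using AB(2) by blast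
    then have "e \<inter> A = {a}" using AB(1) by auto
    then show ?thesis by simp
  qed
  have "card (\<Union>M \<inter> A) = card (\<Union>e\<in>M. e \<inter> A)" by (simp add: Int_Union2 Int_commute)
  also have "\<dots> = (\<Sum>e\<in>M. card (e \<inter> A))"
  proof (rule card_UN_disjoint)
    show "finite M" by (rule matching_finite[OF assms(1,2)])
    show "\<forall>e\<in>M. finite (e \<inter> A)" using one by (metis card.infinite zero_neq_one)
    show "\<forall>e\<in>M. \<forall>f\<in>M. e \<noteq> f \<longrightarrow> (e \<inter> A) \<inter> (f \<inter> A) = {}"
      using assms(2) unfolding matching_def by blast
  qed
  also have "\<dots> = card M" using one by simp
  finally show ?thesis .
qed

lemma bipartite_edge_stable_vertex_stable:
  assumes G: "graph V E" and B: "bipartite V E" and S: "edge_stable_equimatchable V E"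
  shows "vertex_stable_equimatchable V E"
proof -
  have eq: "equimatchable V E" using S unfolding edge_stable_equimatchable_def by simp
  have "equimatchable (V - {v}) (delete_vertex_edges E v)" for v
    unfolding equimatchable_delete_vertex_iff[OF G]
  proof (intro allI impI, rule ccontr)
    fix M M' assume M: "matching E M" "matching E M'" "v \<notin> \<Union>M" "v \<notin> \<Union>M'" "card M < card M'"
      and no: "\<not> (\<exists>e\<in>E. v \<notin> e \<and> e \<inter> \<Union>M = {})"
    \<comment> \<open>The graph itself provides a free edge \<open>e\<close> at \<open>v\<close>;
      deleting \<open>e\<close> then forces a second one, \<open>f\<close>.\<close>
    obtain e where e: "e \<in> E" "e \<inter> \<Union>M = {}" using eq equimatchable_iff[OF G] M(1,2,5) by meson
    then have "v \<in> e" using no by blast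
    then obtain s where s: "e = {v, s}" using graph_edge_other[OF G e(1)] by metis
    have "equimatchable V (E - {e})" using S e(1) unfolding edge_stable_equimatchable_def by blast
    moreover have "e \<notin> M" "e \<notin> M'" using \<open>v \<in> e\<close> M(3,4) by blast+
    ultimately obtain f where f: "f \<in> E" "f \<noteq> e" "f \<inter> \<Union>M = {}"
      using equimatchable_delete_edge_iff[OF G] M(1,2,5) by meson
    then have "v \<in> f" using no by blast
    then obtain t where t: "f = {v, t}" using graph_edge_other[OF G f(1)] by metis
    have st: "s \<noteq> t" "s \<notin> \<Union>M" "t \<notin> \<Union>M" using e f s t by auto
    have E: "{v, s} \<in> E" "{v, t} \<in> E" using e(1) f(1) s t by simp_all
    obtain N where N: "matching E N" "N \<subseteq> M \<union> M'" "card N = Suc (card M)" "\<Union>M \<subseteq> \<Union>N"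
      using matching_augment[OF G M(1,2,5)] by blast
    have vN: "v \<notin> \<Union>N" using N(2) M(3,4) by blast
    \<comment> \<open>\<open>M\<close> plus \<open>{v, s}\<close> leaves no free edge, since such an
      edge would avoid \<open>v\<close> and be free for \<open>M\<close>. Hence its size is the
      maximum.\<close>
    have max: "card N' \<le> Suc (card M)" if N': "matching E N'" for N'
    proof (rule ccontr)
      assume large: "\<not> ?thesis"
      obtain M1 where M1: "matching E M1" "card M1 = Suc (card M)" "\<Union>M1 = {v, s} \<union> \<Union>M"
        using matching_add1[OF G M(1) E(1) M(3) st(2)] by blast
      have "card M1 < card N'" using large M1(2) by simp
      then obtain g where g: "g \<in> E" "g \<inter> \<Union>M1 = {}"
        using eq equimatchable_iff[OF G] M1(1) N' by meson
      then have "v \<notin> g" "g \<inter> \<Union>M = {}" unfolding M1(3) by auto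
      with g(1) no show False by metis
    qed
    have cov: "r \<in> \<Union>N" if r: "{v, r} \<in> E" for r
    proof (rule ccontr)
      assume "r \<notin> \<Union>N"
      then obtain N' where "matching E N'" "card N' = Suc (card N)"
        using matching_add1[OF G N(1) r vN] by blast
      with max[of N'] N(3) show False by simp
    qed
    obtain X Y where XY: "X \<inter> Y = {}" "\<forall>e\<in>E. \<exists>a\<in>X. \<exists>b\<in>Y. e = {a, b}"
      using B unfolding bipartite_def by blast
    have XY': "Y \<inter> X = {}" "\<forall>e\<in>E. \<exists>a\<in>Y. \<exists>b\<in>X. e = {a, b}"
      using XY by (blast, metis insert_commute)
    \<comment> \<open>\<open>Z\<close> is the side opposite to \<open>v\<close>. \<open>N\<close>
      covers \<open>card M + 1\<close> vertices of \<open>Z\<close>, yet these include the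
      \<open>card M\<close> covered by \<open>M\<close> as well as \<open>s\<close> and
      \<open>t\<close>.\<close>
    have side: False if Z: "Z \<inter> Z' = {}" "\<forall>e\<in>E. \<exists>a\<in>Z. \<exists>b\<in>Z'. e = {a, b}" "v \<in> Z'" for Z Z'
    proof -
      have "r \<in> Z" if "{v, r} \<in> E" for r using Z that by (fastforce simp: doubleton_eq_iff)
      then have "{s, t} \<union> (\<Union>M \<inter> Z) \<subseteq> \<Union>N \<inter> Z" using cov E N(4) by auto
      moreover have fin: "finite (\<Union>N)"
        by (rule finite_subset[of _ V]) (use G N(1) in \<open>auto simp: graph_def matching_def\<close>)
      ultimately have "card ({s, t} \<union> (\<Union>M \<inter> Z)) \<le> card (\<Union>N \<inter> Z)"
        by (intro card_mono) auto
      also have "\<dots> = Suc (card M)" using card_matching_side[OF G N(1) Z(1,2)] N(3) by simp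
      finally have le: "card ({s, t} \<union> (\<Union>M \<inter> Z)) \<le> Suc (card M)" .
      have "finite (\<Union>M \<inter> Z)" using fin N(4) by (meson finite_Int finite_subset)
      then have "card ({s, t} \<union> (\<Union>M \<inter> Z)) = Suc (Suc (card (\<Union>M \<inter> Z)))"
        using st by simp
      then show False using le card_matching_side[OF G M(1) Z(1,2)] by simp
    qed
    have "v \<in> X \<or> v \<in> Y" using XY(2) E(1) by (fastforce simp: doubleton_eq_iff)
    then show False using side[OF XY] side[OF XY'] by blast
  qed
  with eq show ?thesis unfolding vertex_stable_equimatchable_def by blast
qed

theorem theorem7p6:
  fixes V :: "'a set" and E :: "'a set set"
  assumes "graph V E" and "connected V E"
  shows "vertex_stable_equimatchable V E \<longleftrightarrow>
           complete_graph V E \<or> complete_bipartite V E \<or>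
           (bipartite V E \<and> edge_stable_equimatchable V E)"
proof
  assume S: "vertex_stable_equimatchable V E"
  show "complete_graph V E \<or> complete_bipartite V E \<or>
    (bipartite V E \<and> edge_stable_equimatchable V E)"
  proof (cases "p4_closed E")
    case True
    then show ?thesis using p4_closed_connected_cases[OF assms] by blast
  next
    case False
    let ?D = "exposable V E"
    \<comment> \<open>The exposable vertices and their complement form the bipartition.\<close>
    have crossing: "\<exists>d\<in>?D. \<exists>u\<in>V - ?D. e = {d, u}" if e: "e \<in> E" for e
    proof -
      obtain p q where pq: "e = {p, q}" "p \<in> V" "q \<in> V" using graph_edge_cases[OF assms(1) e] by metis
      then have "p \<in> ?D \<longleftrightarrow> q \<notin> ?D" using exposable_alternates[OF assms S False] e by blast
      then show ?thesis using pq by (cases "p \<in> ?D") (auto simp: insert_commute)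
    qed
    have "?D \<subseteq> V" unfolding exposable_def by blast
    then have "bipartite V E" unfolding bipartite_def using crossing
      by (intro exI[of _ ?D] exI[of _ "V - ?D"]) auto
    moreover have "edge_stable_equimatchable V E"
      by (rule vertex_stable_edge_stable[OF assms(1) S]) (use crossing in blast)
    ultimately show ?thesis by blast
  qed
next
  assume "complete_graph V E \<or> complete_bipartite V E \<or>
    (bipartite V E \<and> edge_stable_equimatchable V E)"
  then show "vertex_stable_equimatchable V E"
    using p4_closed_vertex_stable[OF assms(1)] complete_p4_closed[OF assms(1)]
      complete_bipartite_p4_closed bipartite_edge_stable_vertex_stable[OF assms(1)] by blast
qed

end
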